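(* Let $p$ be a prime, $n\ge 1$, $q=p^n$, and let $\gamma\in\mathbb{F}_q^*$ have multiplicative order $T=q-1$ (i.e. $\gamma$ generates $\mathbb{F}_q^*$); put $G=\langle\gamma\rangle$. Let $(\beta_1,\ldots,\beta_n)$ be an ordered basis of $\mathbb{F}_q$ over $\mathbb{F}_p$ and let $P:G\to\mathbb{F}_q$ be the map $P(\gamma^x)=\xi_x$ for $x=0,1,\ldots,T-1$ (notation in context). Let $m$ be an integer with $0\le m\le T$ and let $F:\mathbb{F}_q\to\mathbb{F}_q$ be a map with $F(\zeta)=P(\zeta)$ for all but at most $m$ elements $\zeta\in G$. Suppose there exist an $\mathbb{F}_p$-linear subspace $U\le\mathbb{F}_q$ of codimension $k$, a linearised polynomial $M\in\mathbb{F}_q[X]$ and constants $a_V\in\mathbb{F}_q$, one for each coset $V$ of $U$ in $\mathbb{F}_q$, such that $F(\zeta)=M(\zeta)+a_{U+\zeta}$ for all $\zeta\in\mathbb{F}_q$. Then $$p^k\ge \frac{q}{n+2m+2}.$$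
   Context: All linear algebra is over $\mathbb{F}_p$. A linearised polynomial over $\mathbb{F}_q$ is one of the form $\sum_{j=0}^{n-1}c_jX^{p^j}$ with $c_j\in\mathbb{F}_q$. For an integer $0\le x\le q-1$ with base-$p$ expansion $x=x_1+x_2p+\cdots+x_np^{n-1}$, $0\le x_i<p$, one sets $\xi_x=x_1\beta_1+\cdots+x_n\beta_n\in\mathbb{F}_q$ (digits viewed in $\mathbb{F}_p$). The map $P$ is an identification of the discrete logarithm to base $\gamma$ with a map into $\mathbb{F}_q$. *)

theory Defs
  imports Complex_Main "HOL-Computational_Algebra.Polynomial"
    "Berlekamp_Zassenhaus.Finite_Field"
begin

text \<open>
  For a finite field \<open>'a\<close>, the type \<open>'a ring_char mod_ring\<close> is the field of integers modulo the
  characteristic of \<open>'a\<close>, i.e. the prime field.  It acts on \<open>'a\<close> through the integer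
  representatives of its elements.
\<close>

definition Fp_scale :: "'a::finite_field ring_char mod_ring \<Rightarrow> 'a \<Rightarrow> 'a" where
  "Fp_scale c x = of_int (to_int_mod_ring c) * x"

lemma of_int_mod_CHAR: "(of_int (k mod int CHAR('a)) :: 'a::ring_1) = of_int k"
proof -
  have "(of_int k :: 'a) = of_int (int CHAR('a) * (k div int CHAR('a)) + k mod int CHAR('a))"
    by simp
  also have "\<dots> = of_int (k mod int CHAR('a))"
    by (simp only: of_int_add of_int_mult of_int_of_nat_eq of_nat_CHAR) simp
  finally show ?thesis by simp
qed

global_interpretation Fp: vector_space Fp_scale
proof
  fix a b :: "'a ring_char mod_ring" and x y :: 'a
  show "Fp_scale a (x + y) = Fp_scale a x + Fp_scale a y"
    by (simp add: Fp_scale_def algebra_simps)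
  show "Fp_scale (a + b) x = Fp_scale a x + Fp_scale b x"
    by (simp add: Fp_scale_def to_int_mod_ring_add of_int_mod_CHAR algebra_simps)
  show "Fp_scale a (Fp_scale b x) = Fp_scale (a * b) x"
    by (simp add: Fp_scale_def to_int_mod_ring_mult of_int_mod_CHAR algebra_simps)
  show "Fp_scale 1 x = x"
    by (simp add: Fp_scale_def)
qed

definition Fp_ordered_basis :: "nat \<Rightarrow> (nat \<Rightarrow> 'a::finite_field) \<Rightarrow> bool" where
  "Fp_ordered_basis n \<beta> \<longleftrightarrow>
     inj_on \<beta> {1..n} \<and> Fp.independent (\<beta> ` {1..n}) \<and> Fp.span (\<beta> ` {1..n}) = UNIV"

text \<open>The \<open>i\<close>-th base-\<open>p\<close> digit of \<open>x\<close> is counted from \<open>i = 1\<close>, the coefficient of \<open>p ^ (i - 1)\<close>.\<close>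

definition digit_elem :: "nat \<Rightarrow> nat \<Rightarrow> (nat \<Rightarrow> 'a::finite_field) \<Rightarrow> nat \<Rightarrow> 'a" where
  "digit_elem p n \<beta> x = (\<Sum>i=1..n. Fp_scale (of_nat (x div p ^ (i - 1) mod p)) (\<beta> i))"

text \<open>Only meaningful for elements of finite order, which all nonzero elements of a finite field are.\<close>

definition mult_order :: "'a::finite_field \<Rightarrow> nat" where
  "mult_order x = (LEAST k. 0 < k \<and> x ^ k = 1)"

definition cyclic_subgroup :: "'a::field \<Rightarrow> 'a set" where
  "cyclic_subgroup x = range (\<lambda>j::int. x powi j)"

definition linearised_poly :: "nat \<Rightarrow> nat \<Rightarrow> 'a::field poly \<Rightarrow> bool" where
  "linearised_poly p n M \<longleftrightarrow> (\<exists>c. M = (\<Sum>j<n. monom (c j) (p ^ j)))"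

end

theory Submission
  imports Defs
begin

text \<open>
  Shifting the exponent by one, \<open>x \<mapsto> x + 1\<close>, changes \<open>\<xi>\<^sub>x\<close> by one of the \<open>n\<close> partial sums
  \<open>\<beta>\<^sub>1 + \<dots> + \<beta>\<^sub>j\<close>, according to the number of carries.  For \<open>\<eta> \<in> U\<close> put \<open>\<zeta> = \<eta> / (\<gamma> - 1)\<close>; then \<open>\<zeta>\<close>
  and \<open>\<gamma> \<zeta>\<close> lie in the same coset of \<open>U\<close>, so \<open>F (\<gamma> \<zeta>) - F \<zeta> = M \<eta>\<close>.  Hence \<open>M \<eta>\<close> is one of these partial
  sums for all but at most \<open>2m + 2\<close> elements \<open>\<eta>\<close> of \<open>U\<close>.  If \<open>M\<close> is injective on \<open>U\<close>, this
  gives \<open>|U| \<le> n + 2m + 2\<close>.  Otherwise \<open>M\<close> kills some nonzero \<open>\<kappa> \<in> U\<close>, and since \<open>P\<close> is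
  injective, at most one of \<open>\<zeta>\<close>, \<open>\<zeta> + \<kappa>\<close> can be a nonzero point of agreement of \<open>F\<close> and \<open>P\<close>;
  so at least half of \<open>U\<close> is exceptional and \<open>|U| \<le> 2m + 2\<close>.
\<close>

section \<open>Base-\<open>p\<close> digits and carries\<close>

lemma Fp_scale_of_nat: "Fp_scale (of_nat c) x = of_nat c * x"
  by (induction c) (simp_all add: Fp.scale_left_distrib algebra_simps)

lemma digit_elem_Suc:
  "digit_elem p (Suc n) \<beta> x =
     of_nat (x mod p) * \<beta> 1 + digit_elem p n (\<lambda>i. \<beta> (Suc i)) (x div p)"
proof -
  have "digit_elem p (Suc n) \<beta> x = of_nat (x mod p) * \<beta> 1
      + (\<Sum>i=Suc 1..Suc n. of_nat (x div p ^ (i - 1) mod p) * \<beta> i)"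
    unfolding digit_elem_def Fp_scale_of_nat
    by (subst sum.atLeast_Suc_atMost) simp_all
  also have "(\<Sum>i=Suc 1..Suc n. of_nat (x div p ^ (i - 1) mod p) * \<beta> i)
      = (\<Sum>i=1..n. of_nat (x div p ^ i mod p) * \<beta> (Suc i))"
    by (subst sum.shift_bounds_cl_Suc_ivl) simp
  also have "\<dots> = digit_elem p n (\<lambda>i. \<beta> (Suc i)) (x div p)"
    unfolding digit_elem_def Fp_scale_of_nat
  proof (rule sum.cong)
    fix i assume "i \<in> {1..n}"
    then have "p ^ i = p * p ^ (i - 1)"
      by (cases i) auto
    then show "of_nat (x div p ^ i mod p) * \<beta> (Suc i)
        = of_nat (x div p div p ^ (i - 1) mod p) * \<beta> (Suc i)"
      by (simp add: div_mult2_eq)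
  qed simp
  finally show ?thesis .
qed

text \<open>Induction on the number of digits. Without a carry only the lowest digit grows; with
  one, the carry goes on to the higher digits and the shifted basis. The bound on
  \<open>Suc x\<close> makes the carries stop within \<open>n\<close> digits.\<close>

lemma digit_elem_step:
  fixes \<beta> :: "nat \<Rightarrow> 'a::finite_field"
  assumes "CHAR('a) = p" "p > 0" "Suc x < p ^ n"
  shows "\<exists>j\<in>{1..n}. digit_elem p n \<beta> (Suc x) - digit_elem p n \<beta> x = sum \<beta> {1..j}"
  using assms(3)
proof (induction n arbitrary: x \<beta>)
  case 0
  then show ?case by simp
next
  case (Suc n)
  show ?case
  proof (cases "Suc (x mod p) = p")
    case False
    then have "Suc x mod p = Suc (x mod p)" "Suc x div p = x div p"
      by (simp_all add: mod_Suc div_Suc)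
    then show ?thesis
      by (intro bexI[of _ 1]) (simp_all add: digit_elem_Suc algebra_simps)
  next
    case True
    then have *: "Suc x mod p = 0" "Suc x div p = Suc (x div p)"
      by (simp_all add: mod_Suc div_Suc)
    then have "Suc (x div p) < p ^ n"
      using Suc.prems \<open>p > 0\<close> by (metis less_mult_imp_div_less mult.commute power_Suc)
    then obtain j where j: "j \<in> {1..n}"
      "digit_elem p n (\<lambda>i. \<beta> (Suc i)) (Suc (x div p)) - digit_elem p n (\<lambda>i. \<beta> (Suc i)) (x div p)
        = (\<Sum>i=1..j. \<beta> (Suc i))"
      using Suc.IH by blast
    \<comment> \<open>The lowest digit is \<open>p - 1\<close>, which is -1 in \<open>'a\<close>, so
      its reset to 0 contributes \<open>+\<beta> 1\<close> as well.\<close>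
    have "(of_nat (x mod p) :: 'a) + 1 = of_nat p"
      by (metis True add.commute of_nat_Suc)
    also have "\<dots> = 0"
      using assms(1) of_nat_CHAR[where ?'a='a] by simp
    finally have "(of_nat (x mod p) :: 'a) = -1"
      by (simp add: eq_neg_iff_add_eq_0)
    then have "digit_elem p (Suc n) \<beta> (Suc x) - digit_elem p (Suc n) \<beta> x
        = \<beta> 1 + (\<Sum>i=1..j. \<beta> (Suc i))"
      using j(2) by (simp add: digit_elem_Suc *)
    also have "\<dots> = sum \<beta> {1..Suc j}"
      by (subst (2) sum.atLeast_Suc_atMost) (simp_all add: sum.shift_bounds_cl_Suc_ivl del: sum.cl_ivl_Suc)
    finally show ?thesis
      using j(1) by (intro bexI[of _ "Suc j"]) auto
  qed
qed

lemma eq_if_digits_eq: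
  fixes x y p n :: nat
  assumes "x < p ^ n" "y < p ^ n" "\<And>i. i < n \<Longrightarrow> x div p ^ i mod p = y div p ^ i mod p"
  shows "x = y"
  using assms
proof (induction n arbitrary: x y)
  case 0
  then show ?case by simp
next
  case (Suc n)
  have "x div p = y div p"
  proof (rule Suc.IH)
    show "x div p < p ^ n" "y div p < p ^ n"
      using Suc.prems(1,2) by (metis less_mult_imp_div_less mult.commute power_Suc)+
    show "x div p div p ^ i mod p = y div p div p ^ i mod p" if "i < n" for i
      using Suc.prems(3)[of "Suc i"] that by (simp add: div_mult2_eq)
  qed
  moreover have "x mod p = y mod p"
    using Suc.prems(3)[of 0] by simp
  ultimately show ?case
    by (metis div_mult_mod_eq)
qed

text \<open>Independence of the basis forces corresponding digits to agree mod \<open>p\<close>,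
  hence to be equal.\<close>

lemma digit_elem_inj:
  fixes \<beta> :: "nat \<Rightarrow> 'a::finite_field"
  assumes "CHAR('a) = p" "p > 0" and basis: "Fp_ordered_basis n \<beta>"
    and "x < p ^ n" "y < p ^ n" and eq: "digit_elem p n \<beta> x = digit_elem p n \<beta> y"
  shows "x = y"
proof (rule eq_if_digits_eq)
  fix i assume "i < n"
  define d where
    "d i = (of_nat (x div p ^ (i - 1) mod p) - of_nat (y div p ^ (i - 1) mod p) :: 'a ring_char mod_ring)" for i
  have inj: "inj_on \<beta> {1..n}" and ind: "Fp.independent (\<beta> ` {1..n})"
    using basis by (auto simp: Fp_ordered_basis_def)
  \<comment> \<open>Independence concerns sums over a set of vectors, so the coefficients are
    reindexed from positions to basis vectors.\<close>
  have "(\<Sum>v\<in>\<beta> ` {1..n}. Fp_scale (d (the_inv_into {1..n} \<beta> v)) v)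
      = (\<Sum>i=1..n. Fp_scale (d i) (\<beta> i))"
    unfolding sum.reindex[OF inj] comp_def
    by (rule sum.cong) (simp_all only: the_inv_into_f_f[OF inj])
  also have "\<dots> = digit_elem p n \<beta> x - digit_elem p n \<beta> y"
    by (simp add: digit_elem_def d_def Fp.scale_left_diff_distrib sum_subtractf)
  finally have "(\<Sum>v\<in>\<beta> ` {1..n}. Fp_scale (d (the_inv_into {1..n} \<beta> v)) v) = 0"
    using eq by simp
  then have "d (the_inv_into {1..n} \<beta> (\<beta> (Suc i))) = 0"
    using \<open>i < n\<close> by (intro Fp.independentD[OF ind]) auto
  then have "d (Suc i) = 0"
    using \<open>i < n\<close> the_inv_into_f_f[OF inj, of "Suc i"] by simp
  \<comment> \<open>Scaling 1 carries the equality from the prime field to \<open>'a\<close>, where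
    it is a congruence modulo the characteristic.\<close>
  then have "Fp_scale (of_nat (x div p ^ i mod p)) (1::'a) = Fp_scale (of_nat (y div p ^ i mod p)) 1"
    by (simp add: d_def)
  then have "[x div p ^ i mod p = y div p ^ i mod p] (mod p)"
    using assms(1) by (simp add: Fp_scale_of_nat of_nat_eq_iff_cong_CHAR)
  then show "x div p ^ i mod p = y div p ^ i mod p"
    by (simp add: cong_def)
qed fact+

section \<open>Subspaces, additivity and cosets\<close>

lemma power_dim_le_card:
  fixes U :: "'a::finite_field set"
  assumes "Fp.subspace U"
  shows "CHAR('a) ^ Fp.dim U \<le> card U"
proof -
  obtain B where B: "B \<subseteq> U" "Fp.independent B" "card B = Fp.dim U"
    using Fp.basis_exists by metis
  \<comment> \<open>Coefficient functions are taken extensional, so that they are determined by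
    their values on \<open>B\<close> and there are finitely many.\<close>
  define C where "C = (B \<rightarrow>\<^sub>E (UNIV :: 'a ring_char mod_ring set))"
  define f where "f u = (\<Sum>v\<in>B. Fp_scale (u v) v)" for u
  have "inj_on f C"
  proof (rule inj_onI)
    fix u w assume uw: "u \<in> C" "w \<in> C" "f u = f w"
    have "(\<Sum>v\<in>B. Fp_scale (u v - w v) v) = 0"
      using uw(3) by (simp add: f_def Fp.scale_left_diff_distrib sum_subtractf)
    then have "u v - w v = 0" if "v \<in> B" for v
      using that by (intro Fp.independentD[OF B(2), of B]) auto
    then show "u = w"
      using uw(1,2) by (intro PiE_ext[of u B _ w]) (auto simp: C_def)
  qed
  moreover have "f ` C \<subseteq> U"
    using B(1) assms by (auto simp: f_def intro!: Fp.subspace_sum Fp.subspace_scale)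
  ultimately have "card C \<le> card U"
    by (intro card_inj_on_le) auto
  then show ?thesis
    by (simp add: C_def card_PiE B(3))
qed

lemma poly_linearised_add:
  fixes M :: "'a::finite_field poly"
  assumes "linearised_poly CHAR('a) n M"
  shows "poly M (x + y) = poly M x + poly M y"
proof -
  obtain c where M: "M = (\<Sum>j<n. monom (c j) (CHAR('a) ^ j))"
    using assms by (auto simp: linearised_poly_def)
  have "(x + y) ^ (CHAR('a) ^ j) = x ^ (CHAR('a) ^ j) + y ^ (CHAR('a) ^ j)" for j
    by (rule freshmans_dream') (auto intro: prime_CHAR_semidom CHAR_pos)
  then show ?thesis
    by (simp add: M poly_sum poly_monom algebra_simps sum.distrib)
qed

lemma coset_eq:
  assumes "Fp.subspace U" "z - w \<in> U"
  shows "(\<lambda>u. u + z) ` U = (\<lambda>u. u + w) ` U"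
proof (intro equalityI image_subsetI)
  fix u assume "u \<in> U"
  then show "u + z \<in> (\<lambda>u. u + w) ` U"
    using Fp.subspace_add[OF assms(1) _ assms(2)] by (intro image_eqI[of _ _ "u + (z - w)"]) auto
next
  fix u assume "u \<in> U"
  then show "u + w \<in> (\<lambda>u. u + z) ` U"
    using Fp.subspace_diff[OF assms(1) _ assms(2)] by (intro image_eqI[of _ _ "u - (z - w)"]) auto
qed

section \<open>Powers of a primitive element\<close>

lemma mult_order_pos_and_power:
  fixes g :: "'a::finite_field"
  assumes "g \<noteq> 0"
  shows "0 < mult_order g" "g ^ mult_order g = 1"
proof -
  have "card {0, 1 :: 'a} \<le> CARD('a)"
    by (rule card_mono) auto
  then have "CARD('a) \<ge> 2"
    by simp
  then have "g * g ^ (CARD('a) - 1) = g * 1"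
    using finite_field_power_card_eq_same[of g]
    by (metis mult.right_neutral power_Suc Suc_diff_1 zero_less_card_finite)
  then have "g ^ (CARD('a) - 1) = 1"
    using assms mult_cancel_left[of g] by blast
  \<comment> \<open>The exponent \<open>CARD('a) - 1\<close> is a candidate for the
    \<open>LEAST\<close> in the definition, so that minimum is attained.\<close>
  then have "0 < mult_order g \<and> g ^ mult_order g = 1"
    unfolding mult_order_def using \<open>CARD('a) \<ge> 2\<close>
    by (intro LeastI[of "\<lambda>k. 0 < k \<and> g ^ k = 1" "CARD('a) - 1"]) simp
  then show "0 < mult_order g" "g ^ mult_order g = 1"
    by auto
qed

lemma powers_inj_on_mult_order:
  fixes g :: "'a::finite_field"
  assumes "g \<noteq> 0"
  shows "inj_on (\<lambda>x. g ^ x) {..<mult_order g}"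
proof (rule linorder_inj_onI')
  fix i j assume ij: "i \<in> {..<mult_order g}" "j \<in> {..<mult_order g}" "i < j"
  show "g ^ i \<noteq> g ^ j"
  proof
    assume "g ^ i = g ^ j"
    moreover have "g ^ j = g ^ i * g ^ (j - i)"
      using ij(3) by (simp flip: power_add)
    ultimately have "g ^ (j - i) = 1"
      using assms by simp
    then have "mult_order g \<le> j - i"
      unfolding mult_order_def using ij(3) by (intro Least_le) auto
    then show False
      using ij by auto
  qed
qed

lemma power_image_primitive:
  fixes g :: "'a::finite_field"
  assumes "g \<noteq> 0" "mult_order g = CARD('a) - 1"
  shows "(\<lambda>x. g ^ x) ` {..<mult_order g} = UNIV - {0}"
proof (rule card_subset_eq)
  show "card ((\<lambda>x. g ^ x) ` {..<mult_order g}) = card (UNIV - {0 :: 'a})"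
    using assms by (subst card_image[OF powers_inj_on_mult_order]) (simp_all add: card_Diff_singleton)
qed (use assms in auto)

section \<open>Exceptional elements and the bound\<close>

lemma card_le_if_periodic_inj_on_Diff:
  fixes U B :: "'a::finite_field set"
  assumes U: "Fp.subspace U" and k: "k \<in> U" "k \<noteq> 0"
    and inj: "inj_on F (U - B)" and per: "\<And>z. z \<in> U \<Longrightarrow> F (z + k) = F z"
  shows "card U \<le> 2 * card B"
proof -
  define S where "S = U - B"
  \<comment> \<open>\<open>z\<close> and \<open>z + k\<close> share a value of \<open>F\<close>, so
    they cannot both avoid \<open>B\<close>. Two disjoint copies of \<open>S\<close> in
    \<open>U\<close> then give 2|S| \<le> |U| \<le> |S| + |B|.\<close>
  have "S \<inter> (\<lambda>z. z + k) ` S = {}"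
  proof (rule ccontr)
    assume "S \<inter> (\<lambda>z. z + k) ` S \<noteq> {}"
    then obtain z where "z \<in> S" "z + k \<in> S"
      by auto
    then have "z + k = z"
      using inj per[of z] by (intro inj_onD[of F "U - B"]) (auto simp: S_def)
    then show False
      using k(2) by simp
  qed
  then have "card (S \<union> (\<lambda>z. z + k) ` S) = 2 * card S"
    by (simp add: card_Un_disjoint card_image)
  moreover have "S \<union> (\<lambda>z. z + k) ` S \<subseteq> U"
    using Fp.subspace_add[OF U _ k(1)] by (auto simp: S_def)
  ultimately have "2 * card S \<le> card U"
    by (metis card_mono finite)
  moreover have "card U \<le> card S + card B"
    using card_mono[of "S \<union> B" U] card_Un_le[of S B] by (force simp: S_def)
  ultimately show ?thesis
    by simp
qed

theorem theorem4p3: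
  fixes p n q T m k :: nat
    and \<gamma> :: "'a::finite_field"
    and \<beta> :: "nat \<Rightarrow> 'a"
    and P F :: "'a \<Rightarrow> 'a"
    and G U :: "'a set"
    and M :: "'a poly"
    and a :: "'a set \<Rightarrow> 'a"
  assumes "prime p" and "n \<ge> 1" and "q = p ^ n" and "CARD('a) = q"
    and "\<gamma> \<noteq> 0" and "T = q - 1" and "mult_order \<gamma> = T"
    and "G = cyclic_subgroup \<gamma>"
    and "Fp_ordered_basis n \<beta>"
    and "\<And>x. x < T \<Longrightarrow> P (\<gamma> ^ x) = digit_elem p n \<beta> x"
    and "m \<le> T"
    and "card {\<zeta> \<in> G. F \<zeta> \<noteq> P \<zeta>} \<le> m"
    and "Fp.subspace U" and "Fp.dim U + k = Fp.dim (UNIV :: 'a set)"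
    and "linearised_poly p n M"
    and "\<And>\<zeta>. F \<zeta> = poly M \<zeta> + a ((\<lambda>u. u + \<zeta>) ` U)"
  shows "real (p ^ k) \<ge> real q / real (n + 2 * m + 2)"
proof -
  have CHAR: "CHAR('a) = p"
    using CHAR_dvd_CARD[where ?'a='a] assms(1,3,4) prime_CHAR_semidom[OF CHAR_pos[where ?'a='a]]
    by (metis prime_dvd_power primes_dvd_imp_eq)
  have p: "p > 0"
    using assms(1) by (simp add: prime_gt_0_nat)
  have T: "T > 0" "\<gamma> ^ T = 1" and powers: "(\<lambda>x. \<gamma> ^ x) ` {..<T} = UNIV - {0}"
    using mult_order_pos_and_power[of \<gamma>] power_image_primitive[of \<gamma>] assms(4-7) by auto
  have log: "\<exists>x<T. \<zeta> = \<gamma> ^ x" if "\<zeta> \<noteq> 0" for \<zeta>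
    using that powers by (metis DiffI UNIV_I imageE lessThan_iff singletonD)
  have P: "P (\<gamma> ^ x) = digit_elem p n \<beta> x" if "x < T" for x
    using that assms(10) by blast
  have Tq: "x < p ^ n" if "x < T" for x
    using that assms(3,6) by simp

  \<comment> \<open>\<open>G\<close> contains every nonzero element, so \<open>B\<close> is bounded
    by \<open>m\<close>. The point 0 is set apart because \<open>P\<close> is prescribed only on
    powers of \<gamma>.\<close>
  define B where "B = {\<zeta>. \<zeta> \<noteq> 0 \<and> F \<zeta> \<noteq> P \<zeta>}"
  have "\<gamma> ^ x \<in> G" for x
    unfolding assms(8) cyclic_subgroup_def by (rule range_eqI[of _ _ "int x"]) simp
  then have "\<zeta> \<in> G" if "\<zeta> \<noteq> 0" for \<zeta>
    using log[OF that] by blast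
  then have "B \<subseteq> {\<zeta> \<in> G. F \<zeta> \<noteq> P \<zeta>}"
    by (auto simp: B_def)
  then have card_B: "card B \<le> m"
    using assms(12) card_mono[of "{\<zeta> \<in> G. F \<zeta> \<noteq> P \<zeta>}" B] by simp
  have card_B0: "card (insert 0 B) \<le> m + 1"
    using card_B by (simp add: card_insert_if)
  have F_eq: "F \<zeta> = P \<zeta>" if "\<zeta> \<notin> insert 0 B" for \<zeta>
    using that by (auto simp: B_def)
  have F_inj: "inj_on F (- insert 0 B)"
  proof (rule inj_onI)
    fix y z assume yz: "y \<in> - insert 0 B" "z \<in> - insert 0 B" "F y = F z"
    obtain i j where ij: "i < T" "y = \<gamma> ^ i" "j < T" "z = \<gamma> ^ j"
      using yz(1,2) log by (metis ComplD insertI1)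
    have "digit_elem p n \<beta> i = digit_elem p n \<beta> j"
      using yz ij F_eq P by auto
    then have "i = j"
      using digit_elem_inj[OF CHAR p assms(9)] Tq ij by blast
    then show "y = z"
      using ij by simp
  qed

  have M_add: "poly M (x + y) = poly M x + poly M y" for x y
    using poly_linearised_add assms(15) CHAR by blast
  have M_diff: "poly M (x - y) = poly M x - poly M y" for x y
    using M_add[of "x - y" y] by simp
  \<comment> \<open>Both points lie in one coset of \<open>U\<close>, so the constants
    \<open>a\<close> cancel.\<close>
  have F_diff: "F y - F z = poly M (y - z)" if "y - z \<in> U" for y z
    using coset_eq[OF assms(13) that] by (simp add: assms(16) M_diff)

  have "card U \<le> n + 2 * m + 2"
  proof (cases "inj_on (poly M) U")
    case False
    then obtain y z where yz: "y \<in> U" "z \<in> U" "y \<noteq> z" "poly M y = poly M z"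
      by (auto simp: inj_on_def)
    then have yzU: "y - z \<in> U"
      using Fp.subspace_diff[OF assms(13)] by blast
    have "card U \<le> 2 * card (insert 0 B)"
    proof (rule card_le_if_periodic_inj_on_Diff[OF assms(13) yzU])
      show "inj_on F (U - insert 0 B)"
        using F_inj by (rule inj_on_subset) auto
      show "F (w + (y - z)) = F w" for w
        using F_diff[of "w + (y - z)" w] yzU yz(4) by (simp add: M_diff)
    qed (use yz in auto)
    then show ?thesis
      using card_B0 by simp
  next
    case inj: True
    show ?thesis
    \<comment> \<open>Division by \<open>\<gamma> - 1\<close> fails only for \<gamma> = 1; then the
      field has at most two elements and the bound is trivial.\<close>
    proof (cases "\<gamma> = 1")
      case True
      then have "mult_order \<gamma> \<le> 1"
        unfolding mult_order_def by (intro Least_le) auto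
      then have "CARD('a) \<le> 2"
        using assms(4,6,7) by simp
      then show ?thesis
        using card_mono[of UNIV U] by simp
    next
      case False
      define W where "W = (\<lambda>j. sum \<beta> {1..j}) ` {1..n}"
      \<comment> \<open>Outside \<open>E\<close>, both \<zeta> and \<open>\<gamma> * \<zeta>\<close>
        are points of agreement. The exponent \<open>T - 1\<close> is excluded because its successor
        wraps around to 0 instead of adding one in the digits.\<close>
      define E where "E = {0, \<gamma> ^ (T - 1)} \<union> (B \<union> (\<lambda>z. z / \<gamma>) ` B)"
      have "card E \<le> card {0, \<gamma> ^ (T - 1)} + (card B + card ((\<lambda>z. z / \<gamma>) ` B))"
        unfolding E_def by (intro order.trans[OF card_Un_le] add_left_mono card_Un_le)
      also have "\<dots> \<le> 2 + (m + m)"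
        using card_B card_image_le[of B "\<lambda>z. z / \<gamma>"] by (intro add_mono) (auto simp: card_insert_if)
      finally have card_E: "card E \<le> 2 * m + 2"
        by simp
      have "poly M \<eta> \<in> W" if \<eta>: "\<eta> \<in> U" "\<eta> \<notin> (\<lambda>\<zeta>. (\<gamma> - 1) * \<zeta>) ` E" for \<eta>
      proof -
        define \<zeta> where "\<zeta> = \<eta> / (\<gamma> - 1)"
        have \<eta>_eq: "\<eta> = (\<gamma> - 1) * \<zeta>"
          using False by (simp add: \<zeta>_def)
        then have "\<zeta> \<notin> E"
          using \<eta>(2) by blast
        then have \<zeta>: "\<zeta> \<noteq> 0" "\<zeta> \<noteq> \<gamma> ^ (T - 1)" "\<zeta> \<notin> B" "\<gamma> * \<zeta> \<notin> B"
          using assms(5) by (auto simp: E_def image_iff)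
        obtain x where x: "x < T" "\<zeta> = \<gamma> ^ x"
          using log[OF \<zeta>(1)] by blast
        then have "Suc x < T"
          using \<zeta>(2) by (cases "x = T - 1") auto
        have "poly M \<eta> = F (\<gamma> * \<zeta>) - F \<zeta>"
          using F_diff[of "\<gamma> * \<zeta>" \<zeta>] \<eta>(1) by (simp add: \<eta>_eq algebra_simps)
        also have "\<dots> = P (\<gamma> ^ Suc x) - P (\<gamma> ^ x)"
          using F_eq[of \<zeta>] F_eq[of "\<gamma> * \<zeta>"] \<zeta> assms(5) x(2) by simp
        also have "\<dots> = digit_elem p n \<beta> (Suc x) - digit_elem p n \<beta> x"
          by (simp only: P x(1) \<open>Suc x < T\<close>)
        also have "\<dots> \<in> W"
          using digit_elem_step[OF CHAR p Tq[OF \<open>Suc x < T\<close>], of \<beta>] by (auto simp: W_def)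
        finally show ?thesis .
      qed
      \<comment> \<open>\<open>poly M\<close> embeds the remaining elements of \<open>U\<close> into
        the set \<open>W\<close> of partial sums.\<close>
      then have "card (U - (\<lambda>\<zeta>. (\<gamma> - 1) * \<zeta>) ` E) \<le> card W"
        by (intro card_inj_on_le[of "poly M"] inj_on_subset[OF inj]) auto
      also have "card W \<le> n"
        unfolding W_def using card_image_le[of "{1..n}" "\<lambda>j. sum \<beta> {1..j}"] by simp
      finally have "card (U - (\<lambda>\<zeta>. (\<gamma> - 1) * \<zeta>) ` E) \<le> n" .
      moreover have "card ((\<lambda>\<zeta>. (\<gamma> - 1) * \<zeta>) ` E) \<le> 2 * m + 2"
        using card_E card_image_le[of E "\<lambda>\<zeta>. (\<gamma> - 1) * \<zeta>"] by simp
      moreover have "card U \<le> card (U - (\<lambda>\<zeta>. (\<gamma> - 1) * \<zeta>) ` E) + card ((\<lambda>\<zeta>. (\<gamma> - 1) * \<zeta>) ` E)"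
        using diff_card_le_card_Diff[of "(\<lambda>\<zeta>. (\<gamma> - 1) * \<zeta>) ` E" U] by simp
      ultimately show ?thesis
        by linarith
    qed
  qed
  then have "p ^ Fp.dim U \<le> n + 2 * m + 2"
    using power_dim_le_card[OF assms(13)] CHAR by simp
  \<comment> \<open>The basis fixes the dimension, which turns the codimension \<open>k\<close> into
    the factorisation of \<open>q\<close> below.\<close>
  moreover have "Fp.dim (UNIV :: 'a set) = n"
    using assms(9) Fp.dim_eq_card[of "\<beta> ` {1..n}" UNIV]
    by (simp add: Fp_ordered_basis_def card_image)
  then have "q = p ^ Fp.dim U * p ^ k"
    using assms(3,14) by (simp flip: power_add)
  ultimately have "q \<le> (n + 2 * m + 2) * p ^ k"
    by (simp only: mult_le_mono1)
  then have "real q \<le> real (p ^ k) * real (n + 2 * m + 2)"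
    by (metis mult.commute of_nat_le_iff of_nat_mult)
  then show ?thesis
    by (simp add: divide_le_eq)
qed

end
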